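(* Let $n\ge 0$ be a fixed integer. The extremal polynomials $b_{j,n}(T)$ ($j=0,1,\ldots,n$) have integer coefficients, and the following hold: (1) For every prime $p\ge 2n+5$ and every integer $k\ge 1$, $$\binom{kp-1}{p-1}\equiv \sum_{j=0}^{n} b_{j,n}(k)\,p^j H(\{1\}^j;p-1)\pmod{p^{2n+3}}.$$ (2) If $p=2n+3$ is prime, then for every integer $k\ge 1$, $$\binom{kp-1}{p-1}\equiv \sum_{j=0}^{n} b_{j,n}(k)\,p^j H(\{1\}^j;p-1)\pmod{p^{2n+2}}.$$ (3) For every prime $p$ with $3\le p\le 2n+1$ and every integer $k\ge 1$, $$\binom{kp-1}{p-1}= \sum_{j=0}^{n} b_{j,n}(k)\,p^j H(\{1\}^j;p-1).$$
   Context: For non-negative integers $j,m$, the elementary symmetric multiple harmonic sum is $H(\{1\}^j;m)=\sum_{m\ge i_1>i_2>\cdots>i_j\ge 1}\frac{1}{i_1 i_2\cdots i_j}\in\mathbb{Q}$, with $H(\{1\}^0;m)=1$ and $H(\{1\}^j;m)=0$ if $j>m$. For integers $0\le j\le n$, the extremal polynomial $b_{j,n}(T)\in\mathbb{Q}[T]$ is the unique polynomial of degree at most $2n+1$ satisfying $b_{j,n}(T)\equiv (T-1)^j \pmod{(T-1)^{n+1}}$ and $b_{j,n}(T)\equiv (-1)^jT^j\pmod{T^{n+1}}$ in $\mathbb{Q}[T]$. Congruences modulo $p^m$ are between rational numbers with denominators prime to $p$: $x\equiv y\pmod{p^m}$ means $x-y$ has $p$-adic valuation at least $m$. *)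

theory Defs
  imports "HOL-Computational_Algebra.Computational_Algebra" "HOL-Computational_Algebra.Field_as_Ring"
    "HOL-Number_Theory.Cong"
begin

(* Index tuples i_1 > ... > i_j are strictly decreasing lists; for j = 0 only the
   empty list occurs, and for j > m there is none. *)
definition harmonic_indices :: "nat \<Rightarrow> nat \<Rightarrow> nat list set" where
  "harmonic_indices j m = {is. length is = j \<and> sorted_wrt (>) is \<and> set is \<subseteq> {1..m}}"

definition elem_harmonic :: "nat \<Rightarrow> nat \<Rightarrow> rat" where
  "elem_harmonic j m = (\<Sum>is\<in>harmonic_indices j m. 1 / of_nat (prod_list is))"

(* In particular the sum above is never the default value of an infinite sum. *)
lemma finite_harmonic_indices: "finite (harmonic_indices j m)"
proof (rule finite_subset)
  show "harmonic_indices j m \<subseteq> {is. set is \<subseteq> {1..m} \<and> length is = j}"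
    by (auto simp: harmonic_indices_def)
  show "finite {is. set is \<subseteq> {1..m} \<and> length is = j}"
    by (rule finite_lists_length_eq) simp
qed

lemma elem_harmonic_0: "elem_harmonic 0 m = 1"
proof -
  have "harmonic_indices 0 m = {[]}"
    by (auto simp: harmonic_indices_def)
  then show ?thesis
    by (simp add: elem_harmonic_def)
qed

lemma elem_harmonic_eq_0:
  assumes "j > m"
  shows "elem_harmonic j m = 0"
proof -
  have "length is \<le> m" if "sorted_wrt (>) is" "set is \<subseteq> {1..m}" for "is" :: "nat list"
  proof -
    have "distinct is"
      using that(1) by (induction "is") auto
    then have "length is = card (set is)"
      by (simp add: distinct_card)
    also have "\<dots> \<le> card {1..m}"
      using that(2) by (intro card_mono) auto
    finally show ?thesis by simp
  qed
  then have "harmonic_indices j m = {}"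
    using assms by (fastforce simp: harmonic_indices_def)
  then show ?thesis
    by (simp add: elem_harmonic_def)
qed

definition is_extremal_poly :: "nat \<Rightarrow> nat \<Rightarrow> rat poly \<Rightarrow> bool" where
  "is_extremal_poly j n b \<longleftrightarrow>
     degree b \<le> 2 * n + 1 \<and>
     [b = ([:0, 1:] - 1) ^ j] (mod ([:0, 1:] - 1) ^ (n + 1)) \<and>
     [b = (- 1) ^ j * [:0, 1:] ^ j] (mod [:0, 1:] ^ (n + 1))"

definition extremal_poly :: "nat \<Rightarrow> nat \<Rightarrow> rat poly" where
  "extremal_poly j n = (THE b. is_extremal_poly j n b)"

lemma ex1_extremal_poly: "\<exists>!b. is_extremal_poly j n b"
proof -
  define u v :: "rat poly" where "u = ([:0, 1:] - 1) ^ (n + 1)" and "v = [:0, 1:] ^ (n + 1)"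
  define f g :: "rat poly" where "f = ([:0, 1:] - 1) ^ j" and "g = (- 1) ^ j * [:0, 1:] ^ j"
  have X1: "[:0, 1:] - 1 = [:- 1, 1 :: rat:]"
    by (simp add: one_pCons)
  have "coprime ([:0, 1:] - 1) [:0, 1 :: rat:]"
  proof (rule coprimeI)
    fix c :: "rat poly"
    assume "c dvd [:0, 1:] - 1" "c dvd [:0, 1:]"
    then have "c dvd [:0, 1:] - ([:0, 1:] - 1)"
      by (rule dvd_diff[rotated])
    then show "is_unit c" by simp
  qed
  then have cop: "coprime u v"
    unfolding u_def v_def by (simp only: coprime_power_left_iff coprime_power_right_iff simp_thms)
  have nz: "u \<noteq> 0" "v \<noteq> 0"
    unfolding u_def v_def X1 by (simp_all only: power_eq_0_iff pCons_eq_0_iff one_neq_zero simp_thms not_False_eq_True)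
  have deg: "degree (u * v) = 2 * n + 2"
  proof -
    have "degree u = n + 1" "degree v = n + 1"
      unfolding u_def v_def X1 by (subst degree_power_eq; simp)+
    with nz show ?thesis by (simp add: degree_mult_eq)
  qed
  obtain x y where xy: "x * u + y * v = 1"
    using bezout_coefficients_fst_snd[of u v] coprime_imp_gcd_eq_1[OF cop] by auto
  have ext: "is_extremal_poly j n b \<longleftrightarrow> degree b \<le> 2 * n + 1 \<and> [b = f] (mod u) \<and> [b = g] (mod v)" for b
    unfolding is_extremal_poly_def u_def v_def f_def g_def ..
  define c where "c = g * x * u + f * y * v"
  have "c - f = u * (x * (g - f))"
  proof -
    have "c - f = c - f * (x * u + y * v)" by (simp add: xy)
    then show ?thesis by (simp add: c_def algebra_simps)
  qed
  then have cf: "[c = f] (mod u)"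
    by (simp add: cong_iff_dvd_diff)
  have "c - g = v * (y * (f - g))"
  proof -
    have "c - g = c - g * (x * u + y * v)" by (simp add: xy)
    then show ?thesis by (simp add: c_def algebra_simps)
  qed
  then have cg: "[c = g] (mod v)"
    by (simp add: cong_iff_dvd_diff)
  have cc: "[c mod (u * v) = c] (mod u * v)" by simp
  show ?thesis
  proof (rule ex1I)
    have "degree (c mod (u * v)) \<le> 2 * n + 1"
      using degree_mod_less[of "u * v" c] nz deg by auto
    moreover have "[c mod (u * v) = f] (mod u)" "[c mod (u * v) = g] (mod v)"
      using cong_trans[OF cong_dvd_modulus[OF cc dvd_triv_left] cf]
        cong_trans[OF cong_dvd_modulus[OF cc dvd_triv_right] cg] by auto
    ultimately show "is_extremal_poly j n (c mod (u * v))"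
      by (simp add: ext)
  next
    fix b assume "is_extremal_poly j n b"
    then have b: "degree b \<le> 2 * n + 1" "[b = f] (mod u)" "[b = g] (mod v)"
      by (simp_all add: ext)
    have "u dvd b - c" "v dvd b - c"
      using cong_trans[OF b(2) cong_sym[OF cf]] cong_trans[OF b(3) cong_sym[OF cg]]
      by (simp_all only: cong_iff_dvd_diff)
    then have "u * v dvd b - c"
      using cop by (simp add: divides_mult)
    then have "b mod (u * v) = c mod (u * v)"
      by (simp add: mod_eq_dvd_iff)
    moreover have "b mod (u * v) = b"
      using b(1) deg by (simp add: mod_poly_less)
    ultimately show "b = c mod (u * v)" by simp
  qed
qed

(* Only meaningful for nonzero arguments. *)
definition padic_val :: "nat \<Rightarrow> rat \<Rightarrow> int" where
  "padic_val p x =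
     int (multiplicity (int p) (fst (quotient_of x))) - int (multiplicity (int p) (snd (quotient_of x)))"

definition p_integral :: "nat \<Rightarrow> rat \<Rightarrow> bool" where
  "p_integral p x \<longleftrightarrow> coprime (snd (quotient_of x)) (int p)"

(* x is congruent to y modulo p ^ m; the disjunct x = y accounts for the valuation
   of 0 being infinite, whereas multiplicity of 0 is 0. *)
definition padic_cong :: "nat \<Rightarrow> nat \<Rightarrow> rat \<Rightarrow> rat \<Rightarrow> bool" where
  "padic_cong p m x y \<longleftrightarrow>
     p_integral p x \<and> p_integral p y \<and> (x = y \<or> padic_val p (x - y) \<ge> int m)"

end

theory Submission
  imports Defs "HOL-Number_Theory.Residues"
begin

hide_const (open) Module.smult UnivPoly.coeff UnivPoly.monom

text \<open>With $H_j = H(\{1\}^j; p-1)$, the polynomial $F(X) = \sum_{j<p} p^j H_j (X-1)^j =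
  \prod_{0<i<p} (1 + (X-1) p / i)$ takes the value $\binom{kp-1}{p-1}$ at $k$, and for odd $p$ the
  symmetry $i \mapsto p - i$ gives $F(X) = \sum_{j<p} p^j H_j (-X)^j$. Hence
  $B = \sum_{j \le n} p^j H_j b_{j,n}$ is the remainder of $F$ modulo the monic integral
  polynomial $W = (X-1)^{n+1} X^{n+1}$. Dividing each $X^j$ by $W$ over the integers, with
  quotient $q_j$, yields $F - B = W \sum_{2n+2 \le j < p} (-p)^j H_j q_j$. The sum is empty for
  $p \le 2n+1$, and its leading term gains a further factor $p$ if $2n+2 < p-1$, because
  $p$ divides $H_j$ for $0 < j < p-1$.\<close>

section \<open>Elementary symmetric harmonic sums\<close>

text \<open>The head of a strictly decreasing list is its maximum, so it decides the case: either it
  is \<open>Suc m\<close>, or all entries are at most \<open>m\<close>.\<close>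

lemma harmonic_indices_Suc_Suc:
  "harmonic_indices (Suc j) (Suc m) =
     harmonic_indices (Suc j) m \<union> (#) (Suc m) ` harmonic_indices j m"
proof (intro equalityI subsetI)
  fix l assume l: "l \<in> harmonic_indices (Suc j) (Suc m)"
  then obtain a l' where a: "l = a # l'"
    by (cases l) (auto simp: harmonic_indices_def)
  have small: "\<forall>x\<in>set l'. 1 \<le> x \<and> x < a" and "a \<le> Suc m" "1 \<le> a"
      and l': "sorted_wrt (>) l'" "length l' = j"
    using l a by (auto simp: harmonic_indices_def)
  show "l \<in> harmonic_indices (Suc j) m \<union> (#) (Suc m) ` harmonic_indices j m"
  proof (cases "a = Suc m")
    case True
    have "l' \<in> harmonic_indices j m"
      using small l' True by (auto simp: harmonic_indices_def)
    then show ?thesis using a True by simp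
  next
    case False
    then show ?thesis using small l' a \<open>a \<le> Suc m\<close> \<open>1 \<le> a\<close>
      by (force simp: harmonic_indices_def)
  qed
next
  fix l assume "l \<in> harmonic_indices (Suc j) m \<union> (#) (Suc m) ` harmonic_indices j m"
  then show "l \<in> harmonic_indices (Suc j) (Suc m)"
    by (force simp: harmonic_indices_def)
qed

lemma elem_harmonic_Suc_Suc:
  "elem_harmonic (Suc j) (Suc m) =
     elem_harmonic (Suc j) m + elem_harmonic j m / of_nat (Suc m)"
proof -
  have disj: "harmonic_indices (Suc j) m \<inter> (#) (Suc m) ` harmonic_indices j m = {}"
    by (auto simp: harmonic_indices_def)
  have "elem_harmonic (Suc j) (Suc m) = elem_harmonic (Suc j) m +
      (\<Sum>l\<in>(#) (Suc m) ` harmonic_indices j m. 1 / of_nat (prod_list l))"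
    unfolding elem_harmonic_def harmonic_indices_Suc_Suc
    by (rule sum.union_disjoint) (use disj finite_harmonic_indices in auto)
  also have "(\<Sum>l\<in>(#) (Suc m) ` harmonic_indices j m. 1 / of_nat (prod_list l)) =
      elem_harmonic j m / (of_nat (Suc m) :: rat)"
    by (subst sum.reindex)
       (simp_all add: elem_harmonic_def sum_divide_distrib mult.commute del: of_nat_Suc mult_Suc mult_Suc_right)
  finally show ?thesis .
qed

text \<open>The harmonic sums are the elementary symmetric functions of \<open>1/i\<close>. The
  polynomial \<open>y\<close> is left arbitrary because both \<open>p (X - 1)\<close> and
  \<open>- p X\<close> are substituted later.\<close>

lemma prod_one_plus_eq_sum_elem_harmonic:
  fixes y :: "rat poly"
  shows "(\<Prod>i=1..m. 1 + smult (1 / of_nat i) y) = (\<Sum>j\<le>m. smult (elem_harmonic j m) (y ^ j))"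
proof (induction m)
  case 0
  then show ?case by (simp add: elem_harmonic_0)
next
  case (Suc m)
  let ?c = "1 / of_nat (Suc m) :: rat"
  \<comment> \<open>The sum may be extended to \<open>Suc m\<close>, where the harmonic sum
    vanishes; splitting off \<open>j = 0\<close> then leaves the index range of the other
    summand.\<close>
  have shift: "(\<Sum>j\<le>m. smult (elem_harmonic j m) (y ^ j)) =
      1 + (\<Sum>j\<le>m. smult (elem_harmonic (Suc j) m) (y ^ Suc j))"
  proof -
    have "(\<Sum>j\<le>m. smult (elem_harmonic j m) (y ^ j)) =
        (\<Sum>j\<le>Suc m. smult (elem_harmonic j m) (y ^ j))"
      by (simp add: elem_harmonic_eq_0)
    also have "\<dots> = 1 + (\<Sum>j\<le>m. smult (elem_harmonic (Suc j) m) (y ^ Suc j))"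
      by (subst sum.atMost_Suc_shift) (simp add: elem_harmonic_0)
    finally show ?thesis .
  qed
  have "(\<Prod>i=1..Suc m. 1 + smult (1 / of_nat i) y) =
      (\<Sum>j\<le>m. smult (elem_harmonic j m) (y ^ j)) * (1 + smult ?c y)"
    using Suc by simp
  also have "\<dots> = (\<Sum>j\<le>m. smult (elem_harmonic j m) (y ^ j)) +
      (\<Sum>j\<le>m. smult (elem_harmonic j m * ?c) (y ^ Suc j))"
    by (simp add: distrib_left sum_distrib_right sum_distrib_left sum.distrib mult_ac del: of_nat_Suc)
  also have "\<dots> = 1 + (\<Sum>j\<le>m. smult (elem_harmonic (Suc j) (Suc m)) (y ^ Suc j))"
    unfolding shift elem_harmonic_Suc_Suc
    by (simp add: sum.distrib smult_add_left del: of_nat_Suc power_Suc)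
  also have "\<dots> = (\<Sum>j\<le>Suc m. smult (elem_harmonic j (Suc m)) (y ^ j))"
    by (subst sum.atMost_Suc_shift) (simp add: elem_harmonic_0)
  finally show ?case .
qed

text \<open>Multiplying the product of the \<open>1 + X/i\<close> by \<open>m!\<close> gives the
  product of the \<open>i + X\<close>, whose coefficients are unsigned Stirling numbers of the first
  kind. For \<open>m = p - 1\<close> the factor \<open>m!\<close> is prime to \<open>p\<close>, so
  \<open>p\<close>-adic questions become divisibility of integers.\<close>

lemma fact_mult_elem_harmonic:
  "fact m * elem_harmonic j m = of_int (coeff (\<Prod>i=1..m. [:int i, 1:]) j)"
proof (induction m arbitrary: j)
  case 0
  then show ?case
    by (cases j) (simp_all add: elem_harmonic_0 elem_harmonic_eq_0)
next
  case (Suc m)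
  have prod: "(\<Prod>i=1..Suc m. [:int i, 1:]) = [:int (Suc m), 1:] * (\<Prod>i=1..m. [:int i, 1:])"
    by (simp add: mult.commute)
  show ?case
  proof (cases j)
    case 0
    have "fact (Suc m) * elem_harmonic j (Suc m) = of_nat (Suc m) * (fact m * elem_harmonic 0 m)"
      using 0 by (simp add: elem_harmonic_0)
    also have "\<dots> = of_int (coeff (\<Prod>i=1..Suc m. [:int i, 1:]) j)"
      unfolding Suc.IH prod using 0 by simp
    finally show ?thesis .
  next
    case (Suc j')
    have "fact (Suc m) * elem_harmonic j (Suc m) =
        of_nat (Suc m) * (fact m * elem_harmonic (Suc j') m) + fact m * elem_harmonic j' m"
    proof -
      have *: "S * f * (a + b / S) = S * (f * a) + f * b" if "S \<noteq> 0" for S f a b :: rat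
        using that by (simp add: distrib_left mult.assoc)
      show ?thesis
        unfolding Suc elem_harmonic_Suc_Suc fact_Suc by (rule *) (simp del: of_nat_Suc)
    qed
    also have "\<dots> = of_int (int (Suc m) * coeff (\<Prod>i=1..m. [:int i, 1:]) (Suc j') +
        coeff (\<Prod>i=1..m. [:int i, 1:]) j')"
      by (simp only: Suc.IH of_int_add of_int_mult of_int_of_nat_eq)
    also have "int (Suc m) * coeff (\<Prod>i=1..m. [:int i, 1:]) (Suc j') +
        coeff (\<Prod>i=1..m. [:int i, 1:]) j' = coeff (\<Prod>i=1..Suc m. [:int i, 1:]) j"
      unfolding prod Suc
      by (simp only: mult_pCons_left coeff_add coeff_smult coeff_pCons_Suc mult_zero_left
          smult_1_left coeff_0 pCons_0_0 add_0_right mult_1)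
    finally show ?thesis .
  qed
qed

section \<open>Divisibility by a prime\<close>

text \<open>Lagrange's theorem modulo \<open>p\<close>, stated with integer coefficients. Splitting
  off a root \<open>a\<close> leaves a quotient that keeps every other root \<open>b\<close>,
  because \<open>b - a\<close> is invertible modulo \<open>p\<close>.\<close>

lemma prime_dvd_coeff_if_many_roots:
  fixes f :: "int poly"
  assumes "prime p" "finite A" "degree f < card A"
    and "\<And>a. a \<in> A \<Longrightarrow> p dvd poly f a"
    and "\<And>a b. a \<in> A \<Longrightarrow> b \<in> A \<Longrightarrow> a \<noteq> b \<Longrightarrow> \<not> p dvd a - b"
  shows "p dvd coeff f i"
  using assms(2-)
proof (induction "card A" arbitrary: A f i)
  case 0
  then show ?case by simp
next
  case (Suc d)
  then obtain a where a: "a \<in> A" by fastforce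
  define g where "g = synthetic_div f a"
  have f: "f = [:-a, 1:] * g + [:poly f a:]"
    using synthetic_div_correct'[of a f] by (simp add: g_def)
  \<comment> \<open>A constant \<open>f\<close> is treated apart: then \<open>g = 0\<close>, and the
    degree 0 assigned to it need not be below the number of remaining roots.\<close>
  have "p dvd coeff g i" for i
  proof (cases "degree f = 0")
    case True
    then have "g = 0" by (simp add: g_def synthetic_div_eq_0_iff)
    then show ?thesis by simp
  next
    case False
    show ?thesis
    proof (rule Suc.hyps(1)[of "A - {a}"])
      show "d = card (A - {a})" "finite (A - {a})" "degree g < card (A - {a})"
        using Suc.hyps(2) Suc.prems a False by (auto simp: g_def degree_synthetic_div)
    next
      fix b assume b: "b \<in> A - {a}"
      have "poly f b = (b - a) * poly g b + poly f a"
        by (subst f) (simp add: algebra_simps)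
      then have "(b - a) * poly g b = poly f b - poly f a"
        by simp
      then have "p dvd (b - a) * poly g b"
        using Suc.prems(3)[of a] Suc.prems(3)[of b] a b by simp
      moreover have "\<not> p dvd b - a"
        using Suc.prems(4)[of b a] a b by auto
      ultimately show "p dvd poly g b"
        using \<open>prime p\<close> by (simp add: prime_dvd_mult_iff)
    qed (use Suc.prems(4) in auto)
  qed
  moreover have "p dvd poly f a" using Suc.prems(3) a by simp
  ultimately show ?case
    by (subst f) (cases i; simp)
qed

text \<open>By Fermat and Lagrange, the product is congruent to $X^{p-1} - 1$ coefficientwise.\<close>

lemma prime_dvd_coeff_prod:
  assumes "prime p" "0 < j" "j < p - 1"
  shows "int p dvd coeff (\<Prod>i=1..p-1. [:int i, 1:]) j"
proof -
  let ?P = "\<Prod>i=1..p-1. [:int i, 1:]"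
  define D where "D = ?P - (monom 1 (p - 1) - 1)"
  have degP: "degree ?P = p - 1"
    by (subst degree_prod_eq_sum_degree) auto
  have leadP: "coeff ?P (p - 1) = 1"
    using lead_coeff_prod[of "\<lambda>i. [:int i, 1:]" "{1..p-1}"] degP by simp
  \<comment> \<open>Both polynomials are monic of degree \<open>p - 1\<close>, so the leading terms
    cancel and \<open>D\<close> has fewer than \<open>p - 1\<close> roots to spare: it vanishes
    modulo \<open>p\<close> at all of \<open>1..p-1\<close>.\<close>
  have "degree D \<le> p - 1"
    unfolding D_def using degP
    by (intro degree_diff_le) (auto simp: degree_monom_le)
  moreover have "coeff D (p - 1) = 0"
    using assms leadP by (simp add: D_def)
  ultimately have "degree D < p - 1"
    using assms by (metis coeff_0_reflect_poly_0_iff degree_0 eq_zero_or_degree_less gr_implies_not0 neq0_conv)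
  have "int p dvd coeff D j"
  proof (rule prime_dvd_coeff_if_many_roots[of _ "int ` {1..p-1}"])
    show "degree D < card (int ` {1..p - 1})"
      using \<open>degree D < p - 1\<close> by (subst card_image) auto
  next
    fix a assume "a \<in> int ` {1..p-1}"
    then obtain x where x: "a = int x" "1 \<le> x" "x \<le> p - 1" by auto
    \<comment> \<open>The factor with index \<open>p - x\<close> takes the value \<open>p\<close> at
      \<open>x\<close>.\<close>
    have "int p dvd poly [:int (p - x), 1:] a"
      using x by (simp add: of_nat_diff)
    also have "poly [:int (p - x), 1:] a dvd poly ?P a"
      unfolding poly_prod using x by (intro dvd_prodI) auto
    finally have "int p dvd poly ?P a" .
    moreover have "[x ^ (p - 1) = 1] (mod p)"
      using x \<open>prime p\<close> by (intro fermat_theorem) (auto dest: dvd_imp_le)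
    then have "int p dvd a ^ (p - 1) - 1"
      unfolding x(1) by (metis cong_iff_dvd_diff cong_int_iff of_nat_1 of_nat_power)
    ultimately show "int p dvd poly D a"
      by (simp add: D_def poly_monom)
  next
    fix a b assume "a \<in> int ` {1..p-1}" "b \<in> int ` {1..p-1}" "a \<noteq> b"
    then have "\<bar>a - b\<bar> < int p" "a - b \<noteq> 0" by auto
    then show "\<not> int p dvd a - b"
      using dvd_imp_le_int[of "a - b" "int p"] by auto
  qed (use assms in auto)
  then show ?thesis
    using assms by (simp add: D_def)
qed

section \<open>Congruences between rational numbers\<close>

lemma p_integralI:
  assumes "of_int d * x = of_int e" "coprime d (int p)"
  shows "p_integral p x"
proof -
  obtain u w where uw: "quotient_of x = (u, w)" by fastforce
  have w: "x = of_int u / of_int w" "w > 0" "coprime u w"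
    using quotient_of_div[OF uw] quotient_of_denom_pos[OF uw] quotient_of_coprime[OF uw] by auto
  have "of_int (d * u) = of_int d * x * of_int w"
    using w by simp
  then have "of_int (d * u) = (of_int (e * w) :: rat)"
    unfolding assms(1) by simp
  then have "d * u = e * w" by (simp only: of_int_eq_iff)
  \<comment> \<open>The reduced denominator divides every integer that clears the denominator of
    \<open>x\<close>.\<close>
  then have "w dvd d"
    using w by (metis coprime_commute coprime_dvd_mult_left_iff dvd_triv_right)
  then have "coprime w (int p)"
    using assms(2) by (rule coprime_divisors[OF _ dvd_refl])
  then show ?thesis
    using uw by (simp add: p_integral_def)
qed

text \<open>A factor \<open>d\<close> prime to \<open>p\<close> does not change the valuation, so
  the numerator of the difference inherits the power of \<open>p\<close>. The same equation shows
  that \<open>d * y\<close> is an integer, which makes \<open>y\<close>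
  \<open>p\<close>-integral.\<close>

lemma padic_congI:
  assumes "of_int d * (of_int a - y) = of_int (int p ^ m * c)" "coprime d (int p)"
    and "prime p"
  shows "padic_cong p m (of_int a) y"
proof -
  define x where "x = of_int a - y"
  obtain u w where uw: "quotient_of x = (u, w)" by fastforce
  have w: "x = of_int u / of_int w" "w > 0" "coprime u w"
    using quotient_of_div[OF uw] quotient_of_denom_pos[OF uw] quotient_of_coprime[OF uw] by auto
  have "of_int d * x = of_int (int p ^ m * c)"
    using assms unfolding x_def by simp
  then have px: "p_integral p x"
    using assms by (intro p_integralI)
  have "of_int (d * u) = of_int d * x * of_int w"
    using w by simp
  then have "of_int (d * u) = (of_int (int p ^ m * c * w) :: rat)"
    unfolding \<open>of_int d * x = _\<close> by simp
  then have "d * u = int p ^ m * c * w" by (simp only: of_int_eq_iff)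
  then have "int p ^ m dvd d * u" by simp
  moreover have "coprime d (int p ^ m)" using assms by simp
  ultimately have "int p ^ m dvd u"
    by (metis coprime_commute coprime_dvd_mult_right_iff)
  moreover have "u \<noteq> 0" if "x \<noteq> 0" using that w by auto
  moreover have "\<not> is_unit (int p)" using \<open>prime p\<close> by auto
  ultimately have "multiplicity (int p) u \<ge> m" if "x \<noteq> 0"
    using that by (intro multiplicity_geI) auto
  moreover have "multiplicity (int p) w = 0"
    using px uw \<open>prime p\<close>
    by (intro not_dvd_imp_multiplicity_0)
       (auto simp: p_integral_def dest: coprime_common_divisor)
  ultimately have "padic_val p x \<ge> int m" if "x \<noteq> 0"
    using that uw by (simp add: padic_val_def)
  moreover have "of_int d * y = of_int (d * a - int p ^ m * c)"
    using assms(1) by (simp add: algebra_simps)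
  then have "p_integral p y" using assms by (intro p_integralI)
  moreover have "p_integral p (of_int a)" by (simp add: p_integral_def)
  ultimately show ?thesis by (auto simp: padic_cong_def x_def)
qed

section \<open>Rational polynomials with integer coefficients\<close>

text \<open>The subring \<open>Z[X]\<close> of \<open>Q[X]\<close>, given as a predicate so that
  integrality is tracked without moving between two polynomial types.\<close>

definition int_coeffs :: "rat poly \<Rightarrow> bool" where
  "int_coeffs f \<longleftrightarrow> (\<forall>i. coeff f i \<in> \<int>)"

lemma int_coeffs_pCons [simp]: "int_coeffs (pCons a f) \<longleftrightarrow> a \<in> \<int> \<and> int_coeffs f"
proof
  assume *: "int_coeffs (pCons a f)"
  have "coeff (pCons a f) i \<in> \<int>" for i
    using * by (simp only: int_coeffs_def)
  from this[of 0] this[of "Suc i" for i] show "a \<in> \<int> \<and> int_coeffs f"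
    by (simp add: int_coeffs_def)
qed (auto simp: int_coeffs_def coeff_pCons split: nat.split)

lemma int_coeffs_0 [simp]: "int_coeffs 0" and int_coeffs_1 [simp]: "int_coeffs 1"
  by (simp_all add: int_coeffs_def coeff_1)

lemma int_coeffs_intros [intro]:
  "int_coeffs f \<Longrightarrow> int_coeffs g \<Longrightarrow> int_coeffs (f + g)"
  "int_coeffs f \<Longrightarrow> int_coeffs g \<Longrightarrow> int_coeffs (f - g)"
  "int_coeffs f \<Longrightarrow> int_coeffs g \<Longrightarrow> int_coeffs (f * g)"
  "c \<in> \<int> \<Longrightarrow> int_coeffs f \<Longrightarrow> int_coeffs (smult c f)"
  by (auto simp: int_coeffs_def coeff_mult)

lemma int_coeffs_power [intro]: "int_coeffs f \<Longrightarrow> int_coeffs (f ^ m)"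
  by (induction m) auto

lemma int_coeffs_poly: "int_coeffs f \<Longrightarrow> x \<in> \<int> \<Longrightarrow> poly f x \<in> \<int>"
  by (induction f) auto

text \<open>No division of coefficients occurs when the divisor is monic. The induction follows
  Horner's scheme: from \<open>f = g q + r\<close> one gets
  \<open>a + X f = g (X q) + (a + X r)\<close>, and the last term needs at most one subtraction of a
  multiple of \<open>g\<close>.\<close>

lemma int_coeffs_div_monic:
  assumes "int_coeffs f" "int_coeffs g" "lead_coeff g = 1" "degree g > 0"
  obtains q r where "f = g * q + r" "int_coeffs q" "int_coeffs r" "degree r < degree g"
  using assms(1)
proof (induction f arbitrary: thesis)
  case 0
  show ?case by (rule 0(1)[of 0 0]) (use assms in auto)
next
  case (pCons a f)
  then have "a \<in> \<int>" "int_coeffs f" by auto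
  then obtain q r where qr: "f = g * q + r" "int_coeffs q" "int_coeffs r" "degree r < degree g"
    using pCons.IH by auto
  define c where "c = coeff (pCons a r) (degree g)"
  have c: "c \<in> \<int>"
    using qr(3) \<open>a \<in> \<int>\<close> by (auto simp: c_def int_coeffs_def coeff_pCons split: nat.split)
  define r' where "r' = pCons a r - smult c g"
  have "degree (pCons a r) \<le> degree g" using qr(4) by (simp add: degree_pCons_eq_if)
  then have "degree r' \<le> degree g"
    unfolding r'_def by (intro degree_diff_le) auto
  moreover have "coeff r' (degree g) = 0"
    using assms by (simp add: r'_def c_def)
  \<comment> \<open>Positivity of \<open>degree g\<close> covers \<open>r' = 0\<close>, whose degree
    is 0.\<close>
  ultimately have "degree r' < degree g"
    using assms(4) by (metis degree_0 eq_zero_or_degree_less)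
  moreover have "int_coeffs r'"
    unfolding r'_def using \<open>a \<in> \<int>\<close> c qr(3) assms(2) by (intro int_coeffs_intros) simp_all
  moreover have "pCons a f = g * pCons c q + r'"
    unfolding qr(1) r'_def by simp
  moreover have "int_coeffs (pCons c q)" using c qr by simp
  ultimately show ?case by (intro pCons.prems(1))
qed

text \<open>Inserting \<open>1 = x u + y v\<close> as a factor of the term \<open>x' u ^ m\<close>
  produces one more power of \<open>u\<close>; the rest is absorbed by \<open>v\<close>.\<close>

lemma int_coeffs_bezout_power:
  assumes "x * u + y * v = 1" "int_coeffs x" "int_coeffs y" "int_coeffs u" "int_coeffs v"
  shows "\<exists>x y. x * u ^ m + y * v = 1 \<and> int_coeffs x \<and> int_coeffs y"
proof (induction m)
  case 0
  show ?case by (rule exI[of _ 1], rule exI[of _ 0]) simp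
next
  case (Suc m)
  then obtain x' y' where xy': "x' * u ^ m + y' * v = 1" "int_coeffs x'" "int_coeffs y'" by auto
  have "x * x' * u ^ Suc m + (y * x' * u ^ m + y') * v = (x * u + y * v) * (x' * u ^ m) + y' * v"
    by (simp add: algebra_simps)
  also have "\<dots> = 1" using assms xy' by simp
  finally show ?case
    using assms xy' by (blast intro: int_coeffs_intros int_coeffs_power)
qed

section \<open>Extremal polynomials\<close>

abbreviation extremal_modulus :: "nat \<Rightarrow> rat poly" where
  "extremal_modulus n \<equiv> ([:0, 1:] - 1) ^ (n + 1) * [:0, 1:] ^ (n + 1)"

lemma X_minus_1: "[:0, 1:] - 1 = [:- 1, 1 :: rat:]"
  by (simp add: one_pCons)

lemma int_coeffs_X: "int_coeffs [:0, 1:]" "int_coeffs ([:0, 1:] - 1)"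
  by (simp_all add: X_minus_1)

lemma extremal_modulus_monic:
  "lead_coeff (extremal_modulus n) = 1" "degree (extremal_modulus n) = 2 * n + 2"
  "int_coeffs (extremal_modulus n)"
proof -
  show "lead_coeff (extremal_modulus n) = 1"
    unfolding X_minus_1 by (simp add: lead_coeff_mult lead_coeff_power del: power_Suc)
  have "degree ([:-1, 1 :: rat:] ^ (n + 1)) = n + 1" "degree ([:0, 1 :: rat:] ^ (n + 1)) = n + 1"
    by (subst degree_power_eq; simp)+
  moreover have "[:-1, 1 :: rat:] ^ (n + 1) \<noteq> 0" "[:0, 1 :: rat:] ^ (n + 1) \<noteq> 0"
    by (simp_all del: power_Suc)
  ultimately show "degree (extremal_modulus n) = 2 * n + 2"
    unfolding X_minus_1 by (subst degree_mult_eq) auto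
  show "int_coeffs (extremal_modulus n)"
    using int_coeffs_X by (intro int_coeffs_intros(3) int_coeffs_power)
qed

lemma is_extremal_poly_extremal_poly: "is_extremal_poly j n (extremal_poly j n)"
  unfolding extremal_poly_def by (rule theI'[OF ex1_extremal_poly])

text \<open>The moduli $(X-1)^{n+1}$ and $X^{n+1}$ are comaximal already over the integers, so
  the Chinese remainder construction stays integral.\<close>

lemma int_coeffs_extremal_poly: "int_coeffs (extremal_poly j n)"
proof -
  let ?X = "[:0, 1 :: rat:]"
  define u v where "u = (?X - 1) ^ (n + 1)" and "v = ?X ^ (n + 1)"
  define f g where "f = (?X - 1) ^ j" and "g = (- 1) ^ j * ?X ^ j"
  have uv: "int_coeffs u" "int_coeffs v"
    using int_coeffs_X by (auto simp only: u_def v_def)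
  have m1: "int_coeffs (- 1)" using int_coeffs_intros(2)[of 0 1] by simp
  have "int_coeffs f"
    unfolding f_def using int_coeffs_X by (intro int_coeffs_power)
  moreover have "int_coeffs g"
    unfolding g_def using int_coeffs_X m1 by (intro int_coeffs_intros(3) int_coeffs_power)
  ultimately have fg: "int_coeffs f" "int_coeffs g" by blast+
  \<comment> \<open>\<open>X\<close> and \<open>X - 1\<close> differ by 1. The two factors of this
    integral Bezout relation are raised to the power \<open>n + 1\<close> one after the
    other.\<close>
  have "(- 1) * (?X - 1) + 1 * ?X = 1" by simp
  from int_coeffs_bezout_power[OF this, of "n + 1"] obtain x y where
    xy: "x * u + y * ?X = 1" "int_coeffs x" "int_coeffs y"
    using int_coeffs_X m1 int_coeffs_1 unfolding u_def by blast
  have "y * ?X + x * u = 1" using xy by (simp add: add.commute)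
  from int_coeffs_bezout_power[OF this, of "n + 1"] obtain y x where
    xy: "y * v + x * u = 1" "int_coeffs x" "int_coeffs y"
    using int_coeffs_X uv xy unfolding v_def by blast
  \<comment> \<open>The Chinese remainder solution: \<open>y v\<close> is 1 modulo \<open>u\<close>
    and \<open>x u\<close> is 1 modulo \<open>v\<close>. Division by the monic \<open>u v\<close>
    then lowers its degree, and uniqueness identifies the remainder.\<close>
  define c where "c = g * x * u + f * y * v"
  have "int_coeffs c"
    unfolding c_def using fg uv xy by (intro int_coeffs_intros)
  then obtain q r where qr: "c = (u * v) * q + r" "int_coeffs q" "int_coeffs r" "degree r < degree (u * v)"
    using extremal_modulus_monic[of n] by (elim int_coeffs_div_monic[of c "u * v"]) (auto simp only: u_def v_def)
  have r: "r = c - u * v * q" using qr(1) by simp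
  have "r - f = r - f * (y * v + x * u)" "r - g = r - g * (y * v + x * u)" using xy(1) by simp_all
  then have "r - f = u * (g * x - f * x - v * q)" "r - g = v * (f * y - g * y - u * q)"
    unfolding r c_def by (simp_all add: algebra_simps)
  then have "[r = f] (mod u)" "[r = g] (mod v)" by (simp_all add: cong_iff_dvd_diff)
  moreover have "degree r \<le> 2 * n + 1"
    using qr(4) extremal_modulus_monic(2)[of n] unfolding u_def v_def by linarith
  ultimately have "is_extremal_poly j n r"
    unfolding is_extremal_poly_def u_def v_def f_def g_def by blast
  then show ?thesis
    using ex1_extremal_poly is_extremal_poly_extremal_poly qr(3) by blast
qed

section \<open>The binomial coefficient as a polynomial in \<open>k\<close>\<close>

definition binomial_poly :: "nat \<Rightarrow> rat poly" where
  "binomial_poly p = (\<Sum>j\<le>p-1. smult (of_nat p ^ j * elem_harmonic j (p - 1)) (([:0, 1:] - 1) ^ j))"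

lemma binomial_poly_prod:
  "binomial_poly p = (\<Prod>i=1..p-1. 1 + smult (1 / of_nat i) (smult (of_nat p) ([:0, 1:] - 1)))"
  unfolding prod_one_plus_eq_sum_elem_harmonic binomial_poly_def
  by (simp add: smult_power mult.commute)

text \<open>The binomial coefficient is the product of \<open>((k - 1) p + i) / i\<close> over
  \<open>0 < i < p\<close>, which is the product form of the polynomial at
  \<open>X = k\<close>.\<close>

lemma poly_binomial_poly:
  assumes "p \<ge> 1" "k \<ge> 1"
  shows "poly (binomial_poly p) (of_nat k) = of_nat ((k * p - 1) choose (p - 1))"
proof -
  have eq: "of_nat (k * p - 1) - of_nat (p - 1) + 1 = (of_nat ((k - 1) * p + 1) :: rat)"
  proof -
    have "k * p - 1 + 1 = (k - 1) * p + 1 + (p - 1)"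
      using assms by (cases k; cases p) auto
    then have "of_nat (k * p - 1 + 1) = (of_nat ((k - 1) * p + 1 + (p - 1)) :: rat)" by simp
    then show ?thesis unfolding of_nat_add by (simp add: algebra_simps)
  qed
  have "(of_nat ((k * p - 1) choose (p - 1)) :: rat) =
      pochhammer (of_nat ((k - 1) * p + 1)) (p - 1) / fact (p - 1)"
    by (simp only: binomial_gbinomial gbinomial_pochhammer' eq)
  also have "pochhammer (of_nat ((k - 1) * p + 1) :: rat) (p - 1) =
      (\<Prod>i=1..p-1. of_nat ((k - 1) * p) + of_nat i)"
    unfolding pochhammer_prod
    by (rule prod.reindex_bij_witness[of _ "\<lambda>i. i - 1" Suc]) auto
  also have "(fact (p - 1) :: rat) = (\<Prod>i=1..p-1. of_nat i)"
    by (simp add: fact_prod)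
  also have "(\<Prod>i=1..p-1. of_nat ((k - 1) * p) + of_nat i) / (\<Prod>i=1..p-1. of_nat i) =
      (\<Prod>i=1..p-1. (of_nat ((k - 1) * p) + of_nat i) / (of_nat i :: rat))"
    by (simp add: prod_dividef)
  also have "\<dots> = poly (binomial_poly p) (of_nat k)"
    unfolding binomial_poly_prod poly_prod using assms
    by (intro prod.cong) (auto simp: field_simps of_nat_diff)
  finally show ?thesis by simp
qed

text \<open>The substitution $i \mapsto p - i$ in the product exchanges $X - 1$ and $-X$.\<close>

lemma binomial_poly_reflect:
  assumes "odd p"
  shows "binomial_poly p =
    (\<Sum>j\<le>p-1. smult ((- of_nat p) ^ j * elem_harmonic j (p - 1)) ([:0, 1:] ^ j))"
proof -
  let ?N = "\<Prod>i=1..p-1. of_nat i :: rat"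
  have smult_prod: "smult ?N (\<Prod>i=1..p-1. h i) = (\<Prod>i=1..p-1. smult (of_nat i) (h i))"
    for h :: "nat \<Rightarrow> rat poly"
    by (simp add: prod_smult)
  \<comment> \<open>With denominators cleared, factor \<open>i\<close> is
    \<open>(i - p) + p X\<close>; replacing \<open>i\<close> by \<open>p - i\<close> turns it into
    \<open>- (i - p X)\<close>.\<close>
  have "smult ?N (binomial_poly p) = (\<Prod>i=1..p-1. [:of_nat i - of_nat p, of_nat p:])"
    unfolding binomial_poly_prod smult_prod
    by (intro prod.cong) (auto simp: smult_add_right smult_diff_right one_pCons field_simps)
  also have "\<dots> = (\<Prod>i=1..p-1. - [:of_nat i, - of_nat p:])"
    by (rule prod.reindex_bij_witness[of _ "\<lambda>i. p - i" "\<lambda>i. p - i"]) (auto simp: of_nat_diff)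
  \<comment> \<open>The signs cancel because the number \<open>p - 1\<close> of factors is
    even.\<close>
  also have "\<dots> = (\<Prod>i=1..p-1. [:of_nat i, - of_nat p:])"
    using assms by (subst prod_uminus) auto
  also have "\<dots> = smult ?N (\<Prod>i=1..p-1. 1 + smult (1 / of_nat i) (smult (- of_nat p) [:0, 1:]))"
    unfolding smult_prod by (intro prod.cong) (auto simp: smult_add_right one_pCons)
  also have "\<dots> = smult ?N (\<Sum>j\<le>p-1. smult ((- of_nat p) ^ j * elem_harmonic j (p - 1)) ([:0, 1:] ^ j))"
    unfolding prod_one_plus_eq_sum_elem_harmonic
    by (simp only: smult_power smult_smult mult.commute)
  finally show ?thesis
    by (simp add: smult_eq_iff)
qed

section \<open>The extremal sum as a remainder of the binomial polynomial\<close>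

definition extremal_sum :: "nat \<Rightarrow> nat \<Rightarrow> rat poly" where
  "extremal_sum n p = (\<Sum>j\<le>n. smult (of_nat p ^ j * elem_harmonic j (p - 1)) (extremal_poly j n))"

lemma degree_extremal_sum: "degree (extremal_sum n p) \<le> 2 * n + 1"
  unfolding extremal_sum_def
  using is_extremal_poly_extremal_poly[unfolded is_extremal_poly_def]
  by (intro degree_sum_le) (auto intro: order_trans[OF degree_smult_le])

text \<open>Terms with \<open>j > n\<close> are divisible by \<open>y ^ (n + 1)\<close>, and the
  others agree modulo it. This is applied with \<open>y = X - 1\<close> and with
  \<open>y = - X\<close>.\<close>

lemma power_dvd_sum_diff:
  fixes y z :: "rat poly"
  assumes "\<And>j. j \<le> n \<Longrightarrow> [b j = y ^ j] (mod y ^ (n + 1))"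
    and "\<And>j. j > m \<Longrightarrow> c j = 0"
  shows "y ^ (n + 1) dvd (\<Sum>j\<le>m. smult (c j) (y ^ j)) - (\<Sum>j\<le>n. smult (c j) (b j))"
proof -
  \<comment> \<open>Since \<open>c\<close> vanishes beyond \<open>m\<close>, extending the range
    treats \<open>m < n\<close> and \<open>m \<ge> n\<close> together.\<close>
  have ext: "(\<Sum>j\<le>m. smult (c j) (y ^ j)) = (\<Sum>j\<le>max m n. smult (c j) (y ^ j))"
    by (rule sum.mono_neutral_left) (auto intro: assms(2))
  have split: "{..max m n} = {..n} \<union> {n<..max m n}" by auto
  have "(\<Sum>j\<le>max m n. smult (c j) (y ^ j)) =
      (\<Sum>j\<le>n. smult (c j) (y ^ j)) + (\<Sum>j\<in>{n<..max m n}. smult (c j) (y ^ j))"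
    unfolding split by (rule sum.union_disjoint) auto
  then have "(\<Sum>j\<le>m. smult (c j) (y ^ j)) - (\<Sum>j\<le>n. smult (c j) (b j)) =
      (\<Sum>j\<in>{n<..max m n}. smult (c j) (y ^ j)) - (\<Sum>j\<le>n. smult (c j) (b j - y ^ j))"
    unfolding ext by (simp add: smult_diff_right sum_subtractf)
  moreover have "y ^ (n + 1) dvd (\<Sum>j\<in>{n<..max m n}. smult (c j) (y ^ j))"
    by (intro dvd_sum dvd_smult le_imp_power_dvd) auto
  moreover have "y ^ (n + 1) dvd (\<Sum>j\<le>n. smult (c j) (b j - y ^ j))"
    using assms(1) by (intro dvd_sum dvd_smult) (simp only: cong_iff_dvd_diff atMost_iff)
  ultimately show ?thesis by (simp only: dvd_diff)
qed

text \<open>The expansions of the binomial polynomial in powers of \<open>X - 1\<close> and of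
  \<open>- X\<close> have the same coefficients, and they match the two congruences that define the
  extremal polynomials.\<close>

lemma extremal_modulus_dvd:
  assumes "odd p"
  shows "extremal_modulus n dvd binomial_poly p - extremal_sum n p"
proof (rule divides_mult)
  note ext = is_extremal_poly_extremal_poly[unfolded is_extremal_poly_def]
  have H0: "elem_harmonic j (p - 1) = 0" if "j > p - 1" for j
    using that by (rule elem_harmonic_eq_0)
  show "([:0, 1:] - 1) ^ (n + 1) dvd binomial_poly p - extremal_sum n p"
    unfolding binomial_poly_def extremal_sum_def
    by (rule power_dvd_sum_diff) (use ext H0 in auto)
  let ?c = "\<lambda>j. of_nat p ^ j * elem_harmonic j (p - 1)"
  have dvd_neg: "(- x) ^ m dvd f \<longleftrightarrow> x ^ m dvd f" for m and x f :: "rat poly"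
    by (cases "even m") simp_all
  define X where "X = [:0, 1 :: rat:]"
  have "(- X) ^ (n + 1) dvd
      (\<Sum>j\<le>p-1. smult (?c j) ((- X) ^ j)) - (\<Sum>j\<le>n. smult (?c j) (extremal_poly j n))"
  proof (rule power_dvd_sum_diff)
    fix j
    show "[extremal_poly j n = (- X) ^ j] (mod (- X) ^ (n + 1))"
      using ext[of j n] unfolding power_minus[of X j] cong_iff_dvd_diff X_def[symmetric]
      by (simp only: dvd_neg)
  qed (use H0 in auto)
  moreover have "(\<Sum>j\<le>p-1. smult (?c j) ((- X) ^ j)) = binomial_poly p"
    unfolding binomial_poly_reflect[OF assms] X_def[symmetric]
    by (intro sum.cong refl)
       (simp add: power_minus[of X] power_minus[of "of_nat p :: rat"] minus_one_power_iff)
  ultimately show "[:0, 1:] ^ (n + 1) dvd binomial_poly p - extremal_sum n p"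
    unfolding extremal_sum_def X_def[symmetric] by (simp only: dvd_neg)
  have "coprime ([:0, 1:] - 1) [:0, 1 :: rat:]"
  proof (rule coprimeI)
    fix c :: "rat poly"
    assume "c dvd [:0, 1:] - 1" "c dvd [:0, 1:]"
    then have "c dvd [:0, 1:] - ([:0, 1:] - 1)"
      by (rule dvd_diff[rotated])
    then show "is_unit c" by simp
  qed
  then show "coprime (([:0, 1:] - 1) ^ (n + 1)) ([:0, 1 :: rat:] ^ (n + 1))"
    by (simp only: coprime_power_left_iff coprime_power_right_iff simp_thms)
qed

text \<open>After the quotient parts of \<open>X ^ j\<close> with \<open>j \<ge> 2 * n + 2\<close>
  are removed, the difference has degree below that of the modulus but is still divisible by it, so
  it is 0.\<close>

lemma binomial_poly_minus_extremal_sum: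
  assumes "odd p"
  obtains q where "\<And>j. int_coeffs (q j)"
    "binomial_poly p - extremal_sum n p = extremal_modulus n *
       (\<Sum>j=2*n+2..p-1. smult ((- of_nat p) ^ j * elem_harmonic j (p - 1)) (q j))"
proof -
  define W X where W: "W = extremal_modulus n" and X: "X = [:0, 1 :: rat:]"
  let ?c = "\<lambda>j. (- of_nat p) ^ j * elem_harmonic j (p - 1)"
  have "\<exists>q r. X ^ j = W * q + r \<and> int_coeffs q \<and> degree r < degree W" for j
    using int_coeffs_div_monic[of "X ^ j" W] extremal_modulus_monic[of n] int_coeffs_X
    unfolding W X by (metis int_coeffs_power add_pos_pos zero_less_numeral add_gr_0)
  then obtain q r where qr: "\<And>j. X ^ j = W * q j + r j" "\<And>j. int_coeffs (q j)"
      "\<And>j. degree (r j) < degree W"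
    by metis
  define E where "E = binomial_poly p - extremal_sum n p - W * (\<Sum>j=2*n+2..p-1. smult (?c j) (q j))"
  have "W dvd E"
    unfolding E_def W by (rule dvd_diff[OF extremal_modulus_dvd[OF assms] dvd_triv_left])
  moreover have "degree E < degree W"
  proof -
    \<comment> \<open>Powers below the degree of \<open>W\<close> stay as they are; the others are
      replaced by their remainders.\<close>
    define t where "t j = (if j < 2 * n + 2 then X ^ j else r j)" for j
    have "W * (\<Sum>j=2*n+2..p-1. smult (?c j) (q j)) =
        (\<Sum>j=2*n+2..p-1. smult (?c j) (W * q j))"
      by (simp only: sum_distrib_left mult_smult_right)
    also have "\<dots> = (\<Sum>j\<le>p-1. smult (?c j) (if j < 2 * n + 2 then 0 else W * q j))"
      by (rule sum.mono_neutral_cong_left) auto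
    finally have "E = (\<Sum>j\<le>p-1. smult (?c j) (X ^ j - (if j < 2 * n + 2 then 0 else W * q j)))
        - extremal_sum n p"
      unfolding E_def binomial_poly_reflect[OF assms] X[symmetric]
      by (simp only: smult_diff_right sum_subtractf diff_right_commute)
    moreover have "X ^ j - (if j < 2 * n + 2 then 0 else W * q j) = t j" for j
      using qr(1)[of j] by (simp add: t_def)
    ultimately have E: "E = (\<Sum>j\<le>p-1. smult (?c j) (t j)) - extremal_sum n p"
      by (simp only:)
    have "degree (t j) \<le> 2 * n + 1" for j
      using qr(3)[of j] extremal_modulus_monic(2)[of n] by (auto simp: t_def degree_power_eq W X)
    then have "degree (\<Sum>j\<le>p-1. smult (?c j) (t j)) \<le> 2 * n + 1"
      by (intro degree_sum_le) (auto intro: order_trans[OF degree_smult_le])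
    then have "degree E \<le> 2 * n + 1"
      unfolding E using degree_extremal_sum by (rule degree_diff_le)
    then show ?thesis using extremal_modulus_monic(2)[of n] unfolding W by linarith
  qed
  ultimately have "E = 0"
    using dvd_imp_degree_le[of W E] by fastforce
  then show ?thesis
    using qr(2) unfolding E_def W by (intro that[of q]) (simp_all only: right_minus_eq)
qed

text \<open>The factor \<open>(p - 1)!\<close> turns every harmonic sum in the tail into an integer
  coefficient, so divisibility can be checked term by term.\<close>

lemma fact_mult_binomial_minus_extremal_sum:
  assumes "odd p" "k \<ge> 1"
    and dvd: "\<And>j. j \<ge> 2 * n + 2 \<Longrightarrow> j \<le> p - 1 \<Longrightarrow>
      int p ^ m dvd int p ^ j * coeff (\<Prod>i=1..p-1. [:int i, 1:]) j"
  obtains c where "of_int (fact (p - 1)) *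
    (of_nat ((k * p - 1) choose (p - 1)) - poly (extremal_sum n p) (of_nat k)) = 
      (of_int (int p ^ m * c) :: rat)"
proof -
  let ?C = "\<lambda>j. coeff (\<Prod>i=1..p-1. [:int i, 1:]) j"
  obtain q where q: "\<And>j. int_coeffs (q j)"
    "binomial_poly p - extremal_sum n p = extremal_modulus n *
       (\<Sum>j=2*n+2..p-1. smult ((- of_nat p) ^ j * elem_harmonic j (p - 1)) (q j))"
    using binomial_poly_minus_extremal_sum[OF assms(1), of n] by blast
  have Z: "poly f (of_nat k) \<in> \<int>" if "int_coeffs f" for f
    using that by (rule int_coeffs_poly) simp
  obtain w where w: "poly (extremal_modulus n) (of_nat k) = of_int w"
    using Z[OF extremal_modulus_monic(3)] by (rule Ints_cases)
  have "\<forall>j. \<exists>z. poly (q j) (of_nat k) = of_int z"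
    using Z[OF q(1)] by (auto elim: Ints_cases)
  then obtain z where z: "\<And>j. poly (q j) (of_nat k) = of_int (z j)" by metis
  have "of_nat ((k * p - 1) choose (p - 1)) - poly (extremal_sum n p) (of_nat k) =
      poly (binomial_poly p - extremal_sum n p) (of_nat k)"
    using assms odd_pos[OF assms(1)] by (simp add: poly_binomial_poly)
  also have "\<dots> = of_int w *
      (\<Sum>j=2*n+2..p-1. (- of_nat p) ^ j * elem_harmonic j (p - 1) * of_int (z j))"
    unfolding q(2) poly_mult[of "extremal_modulus n"] w by (simp add: poly_sum z)
  finally have "of_int (fact (p - 1)) *
      (of_nat ((k * p - 1) choose (p - 1)) - poly (extremal_sum n p) (of_nat k)) = of_int w *
      (\<Sum>j=2*n+2..p-1. (- of_nat p) ^ j * (fact (p - 1) * elem_harmonic j (p - 1)) * of_int (z j))"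
    by (simp add: sum_distrib_left mult_ac)
  also have "\<dots> = of_int (w * (\<Sum>j=2*n+2..p-1. (- int p) ^ j * ?C j * z j))"
    unfolding fact_mult_elem_harmonic by simp
  finally have eq: "of_int (fact (p - 1)) *
      (of_nat ((k * p - 1) choose (p - 1)) - poly (extremal_sum n p) (of_nat k)) =
      (of_int (w * (\<Sum>j=2*n+2..p-1. (- int p) ^ j * ?C j * z j)) :: rat)" .
  have "int p ^ m dvd (- int p) ^ j * ?C j" if "j \<in> {2*n+2..p-1}" for j
    using dvd[of j] that by (subst power_minus) (auto simp: minus_one_power_iff)
  then have "int p ^ m dvd w * (\<Sum>j=2*n+2..p-1. (- int p) ^ j * ?C j * z j)"
    by (intro dvd_mult[of _ _ w] dvd_sum dvd_mult2[of _ "_ * coeff _ _"])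
  then obtain c where "w * (\<Sum>j=2*n+2..p-1. (- int p) ^ j * ?C j * z j) = int p ^ m * c"
    by (elim dvdE)
  then show ?thesis using eq that by metis
qed

lemma padic_cong_binomial:
  assumes "prime p" "odd p" "k \<ge> 1"
    and "\<And>j. j \<ge> 2 * n + 2 \<Longrightarrow> j \<le> p - 1 \<Longrightarrow>
      int p ^ m dvd int p ^ j * coeff (\<Prod>i=1..p-1. [:int i, 1:]) j"
  shows "padic_cong p m (of_nat ((k * p - 1) choose (p - 1))) (poly (extremal_sum n p) (of_nat k))"
proof -
  obtain c where c: "of_int (fact (p - 1)) *
    (of_nat ((k * p - 1) choose (p - 1)) - poly (extremal_sum n p) (of_nat k)) = 
      (of_int (int p ^ m * c) :: rat)"
    using fact_mult_binomial_minus_extremal_sum[OF assms(2-4)] by blast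
  have "coprime (fact (p - 1)) p"
    using \<open>prime p\<close> prime_gt_0_nat[of p]
    by (subst coprime_commute) (auto intro!: prime_imp_coprime simp: prime_dvd_fact_iff)
  then have "coprime (int (fact (p - 1))) (int p)" by (simp only: coprime_int_iff)
  then have "padic_cong p m (of_int (int ((k * p - 1) choose (p - 1)))) (poly (extremal_sum n p) (of_nat k))"
    using c \<open>prime p\<close> by (intro padic_congI[of "fact (p - 1)" _ _ _ _ c]) simp_all
  then show ?thesis by simp
qed

theorem theorem1p3:
  fixes n :: nat
  shows
    "(\<forall>j\<le>n. \<forall>i. coeff (extremal_poly j n) i \<in> \<int>) \<and>
     (\<forall>p k :: nat. prime p \<and> p \<ge> 2 * n + 5 \<and> k \<ge> 1 \<longrightarrow>
        padic_cong p (2 * n + 3) (of_nat ((k * p - 1) choose (p - 1)))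
          (\<Sum>j=0..n. poly (extremal_poly j n) (of_nat k) * of_nat p ^ j * elem_harmonic j (p - 1))) \<and>
     (\<forall>p k :: nat. prime p \<and> p = 2 * n + 3 \<and> k \<ge> 1 \<longrightarrow>
        padic_cong p (2 * n + 2) (of_nat ((k * p - 1) choose (p - 1)))
          (\<Sum>j=0..n. poly (extremal_poly j n) (of_nat k) * of_nat p ^ j * elem_harmonic j (p - 1))) \<and>
     (\<forall>p k :: nat. prime p \<and> 3 \<le> p \<and> p \<le> 2 * n + 1 \<and> k \<ge> 1 \<longrightarrow>
        of_nat ((k * p - 1) choose (p - 1)) =
          (\<Sum>j=0..n. poly (extremal_poly j n) (of_nat k) * of_nat p ^ j * elem_harmonic j (p - 1)))"
proof -
  have sum: "(\<Sum>j=0..n. poly (extremal_poly j n) (of_nat k) * of_nat p ^ j * elem_harmonic j (p - 1)) =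
      poly (extremal_sum n p) (of_nat k)" for p k :: nat
    by (simp add: extremal_sum_def poly_sum atMost_atLeast0 mult_ac)
  have odd: "odd p" if "prime p" "p \<ge> 3" for p :: nat
    using that prime_odd_nat by simp
  show ?thesis
    unfolding sum
  proof (intro conjI allI impI)
    show "coeff (extremal_poly j n) i \<in> \<int>" for j i
      using int_coeffs_extremal_poly[of j n] by (simp add: int_coeffs_def)
  next
    fix p k :: nat assume p: "prime p \<and> p \<ge> 2 * n + 5 \<and> k \<ge> 1"
    show "padic_cong p (2 * n + 3) (of_nat ((k * p - 1) choose (p - 1))) (poly (extremal_sum n p) (of_nat k))"
    proof (rule padic_cong_binomial)
      fix j assume j: "j \<ge> 2 * n + 2" "j \<le> p - 1"
      show "int p ^ (2 * n + 3) dvd int p ^ j * coeff (\<Prod>i=1..p-1. [:int i, 1:]) j"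
      \<comment> \<open>Only for the lowest index is \<open>p ^ j\<close> short of the required
        power; the missing \<open>p\<close> divides the coefficient because
        \<open>0 < j < p - 1\<close>.\<close>
      proof (cases "j = 2 * n + 2")
        case True
        have "int p ^ j * int p dvd int p ^ j * coeff (\<Prod>i=1..p-1. [:int i, 1:]) j"
          using p True by (intro mult_dvd_mono prime_dvd_coeff_prod) auto
        moreover have "int p ^ j * int p = int p ^ (2 * n + 3)"
          using True by (simp add: eval_nat_numeral)
        ultimately show ?thesis by simp
      next
        case False
        then show ?thesis using j by (intro dvd_mult2 le_imp_power_dvd) auto
      qed
    qed (use p odd in auto)
  next
    \<comment> \<open>Here the tail consists of \<open>j = p - 1\<close> alone, whose coefficient is
      1, so \<open>p ^ j\<close> is all the divisibility there is in that coefficient term.\<close>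
    fix p k :: nat assume p: "prime p \<and> p = 2 * n + 3 \<and> k \<ge> 1"
    then show "padic_cong p (2 * n + 2) (of_nat ((k * p - 1) choose (p - 1))) (poly (extremal_sum n p) (of_nat k))"
      using odd by (intro padic_cong_binomial dvd_mult2 le_imp_power_dvd) auto
  next
    fix p k :: nat assume p: "prime p \<and> 3 \<le> p \<and> p \<le> 2 * n + 1 \<and> k \<ge> 1"
    obtain q where "binomial_poly p - extremal_sum n p = extremal_modulus n *
       (\<Sum>j=2*n+2..p-1. smult ((- of_nat p) ^ j * elem_harmonic j (p - 1)) (q j))"
      using binomial_poly_minus_extremal_sum[of p n] p odd by blast
    \<comment> \<open>Since \<open>p - 1 \<le> 2 * n\<close>, the tail is empty and the congruence
      becomes an equality.\<close>
    moreover have "{2*n+2..p-1} = {}" using p by auto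
    ultimately have "binomial_poly p - extremal_sum n p = 0"
      by (simp only: sum.empty mult_zero_right)
    then show "of_nat ((k * p - 1) choose (p - 1)) = poly (extremal_sum n p) (of_nat k)"
      using p poly_binomial_poly[of p k] by simp
  qed
qed

end
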